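(* Let $\tau>0$. Let $(\mathbf A,\mathbf B)$ be the companion linearization (see context) of the matrix-valued function $P(\mu)=\sum_{i=1}^d(A_i-\mu B_i)f_i(\mu)$, and let $\sigma\in\mathbb C$. Assume a system with matrix $\mathbf A-\sigma\mathbf B$ and right-hand side $\mathbf y\in\mathbb C^{dn}$ is solved using the block ULP decomposition (see context), where all operations except the system solution with $P(\sigma)$ are performed exactly. Denote the resulting approximate solution by $\mathbf z$ and its residual by $\mathbf p=\mathbf y-(\mathbf A-\sigma\mathbf B)\mathbf z$. If $$\|q\|\le|\alpha|\tau,\qquad\text{where } q=w^{[1]}-P(\sigma)z^{[p]},\quad w^{[1]}=\alpha\,(y^{[1]}-\mathcal U_{12}\,y^{[2:d]}),$$ then $\|\mathbf p\|\le\tau$. Here $p$ is the index with $\mathcal Pe_p=e_1$, $\alpha=e_1^T\mathcal Pf(\sigma)$, and $\mathcal U_{12}$ is the upper-right block of $\mathcal U$.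
   Context: $\|\cdot\|$ is the Euclidean norm. Setting: $A_i,B_i\in\mathbb C^{n\times n}$, $f(\mu)=[f_1(\mu)\cdots f_d(\mu)]^T\ne0$, and $M,N\in\mathbb C^{(d-1)\times d}$ satisfy $(M-\mu N)f(\mu)=0$ and $\operatorname{rank}(M-\mu N)=d-1$. The companion linearization is $$\mathbf A=\begin{bmatrix}A_1\ \cdots\ A_d\\ M\otimes I_n\end{bmatrix},\qquad \mathbf B=\begin{bmatrix}B_1\ \cdots\ B_d\\ N\otimes I_n\end{bmatrix}\in\mathbb C^{dn\times dn}.$$ A vector $\mathbf u\in\mathbb C^{dn}$ is partitioned into consecutive blocks $u^{[1]},\dots,u^{[d]}\in\mathbb C^n$; $u^{[2:d]}$ is the stack of the last $d-1$ blocks. Block ULP decomposition at $\sigma$ (a known result): there is a permutation matrix $\mathcal P\in\mathbb C^{d\times d}$ such that, writing $M=[m_1\ M_2]\mathcal P$, $N=[n_1\ N_2]\mathcal P$ with $m_1,n_1\in\mathbb C^{d-1}$, the matrix $M_2-\sigma N_2$ is invertible; then $\alpha=e_1^T\mathcal Pf(\sigma)\neq0$ and $\mathbf A-\sigma\mathbf B=\mathcal U\mathcal L(\mathcal P\otimes I_n)$ with $$\mathcal L=\begin{bmatrix}P(\sigma)&0\\(m_1-\sigma n_1)\otimes I_n&(M_2-\sigma N_2)\otimes I_n\end{bmatrix},\qquad \mathcal U=\begin{bmatrix}\alpha^{-1}I_n&\mathcal U_{12}\\0&I_{(d-1)n}\end{bmatrix},$$ $\mathcal U_{12}=(\bar{\mathbf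 A}_2-\sigma\bar{\mathbf B}_2)\bigl((M_2-\sigma N_2)^{-1}\otimes I_n\bigr)$, where $[A_1\cdots A_d]=[\bar A_1\ \bar{\mathbf A}_2](\mathcal P\otimes I_n)$ and $[B_1\cdots B_d]=[\bar B_1\ \bar{\mathbf B}_2](\mathcal P\otimes I_n)$ with $\bar A_1,\bar B_1\in\mathbb C^{n\times n}$. Solving with this decomposition means: compute $\mathbf w=\mathcal U^{-1}\mathbf y$ exactly, i.e. $w^{[2:d]}=y^{[2:d]}$ and $w^{[1]}=\alpha(y^{[1]}-\mathcal U_{12}y^{[2:d]})$; compute an approximate solution $z^{[p]}\in\mathbb C^n$ of $P(\sigma)z^{[p]}=w^{[1]}$; compute the remaining blocks exactly by forward substitution in $\mathcal L$, i.e. the vector $\hat{\mathbf z}=(\mathcal P\otimes I_n)\mathbf z$ has first block $\hat z^{[1]}=z^{[p]}$ and $\hat z^{[2:d]}=\bigl((M_2-\sigma N_2)^{-1}\otimes I_n\bigr)\bigl(w^{[2:d]}-((m_1-\sigma n_1)\otimes I_n)z^{[p]}\bigr)$. *)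

theory Defs
  imports
    "HOL-Analysis.L2_Norm"
    "HOL-Combinatorics.Permutations"
    "Jordan_Normal_Form.DL_Rank"
    "Jordan_Normal_Form.Gauss_Jordan_Elimination"
begin

text \<open>
  Indices start at 0, so the blocks \<open>1, \<dots>, d\<close> of the mathematical text are \<open>0, \<dots>, d - 1\<close> here.
  The column vectors \<open>m\<^sub>1\<close> and \<open>n\<^sub>1\<close> are one-column matrices.
\<close>

definition euclid_norm :: "complex vec \<Rightarrow> real" where
  "euclid_norm v = L2_set (\<lambda>i. cmod (v $ i)) {..<dim_vec v}"

definition kron :: "'a :: semiring_0 mat \<Rightarrow> 'a mat \<Rightarrow> 'a mat" (infixl "\<otimes>\<^sub>K" 75) where
  "X \<otimes>\<^sub>K Y = mat (dim_row X * dim_row Y) (dim_col X * dim_col Y)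
     (\<lambda>(i, j). X $$ (i div dim_row Y, j div dim_col Y) * Y $$ (i mod dim_row Y, j mod dim_col Y))"

definition append_cols :: "'a :: zero mat \<Rightarrow> 'a mat \<Rightarrow> 'a mat" (infixr "@\<^sub>c" 65) where
  "X @\<^sub>c Y = four_block_mat X Y (0\<^sub>m 0 (dim_col X)) (0\<^sub>m 0 (dim_col Y))"

definition block_row :: "nat \<Rightarrow> nat \<Rightarrow> (nat \<Rightarrow> 'a mat) \<Rightarrow> 'a mat" where
  "block_row n d A = mat n (d * n) (\<lambda>(r, c). A (c div n) $$ (r, c mod n))"

definition vec_block :: "nat \<Rightarrow> 'a vec \<Rightarrow> nat \<Rightarrow> 'a vec" where
  "vec_block n v i = vec n (\<lambda>j. v $ (i * n + j))"

definition permutation_mat :: "nat \<Rightarrow> 'a :: zero_neq_one mat \<Rightarrow> bool" where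
  "permutation_mat d Q \<longleftrightarrow>
     (\<exists>\<pi>. \<pi> permutes {..<d} \<and> Q = mat d d (\<lambda>(i, j). if i = \<pi> j then 1 else 0))"

text \<open>Only meaningful for invertible square matrices.\<close>

definition inv_mat :: "'a :: field mat \<Rightarrow> 'a mat" where
  "inv_mat X = the (mat_inverse X)"

definition mat_fun ::
  "nat \<Rightarrow> nat \<Rightarrow> (nat \<Rightarrow> complex mat) \<Rightarrow> (nat \<Rightarrow> complex mat) \<Rightarrow> (complex \<Rightarrow> complex vec)
    \<Rightarrow> complex \<Rightarrow> complex mat" where
  "mat_fun n d A B f \<mu> = mat n n (\<lambda>rc. \<Sum>i<d. (f \<mu> $ i \<cdot>\<^sub>m (A i - \<mu> \<cdot>\<^sub>m B i)) $$ rc)"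

text \<open>The two matrices of the companion linearization are \<open>companion n d A M\<close> and
  \<open>companion n d B N\<close>.\<close>

definition companion :: "nat \<Rightarrow> nat \<Rightarrow> (nat \<Rightarrow> complex mat) \<Rightarrow> complex mat \<Rightarrow> complex mat" where
  "companion n d A M = block_row n d A @\<^sub>r (M \<otimes>\<^sub>K 1\<^sub>m n)"

end

theory Submission
  imports Defs
begin

text \<open>
  Only the point \<open>\<sigma>\<close> matters, so put \<open>C\<^sub>i = A\<^sub>i - \<sigma> B\<^sub>i\<close>, \<open>L = M - \<sigma> N\<close>, \<open>r = m\<^sub>1 - \<sigma> n\<^sub>1\<close> and
  \<open>S = M\<^sub>2 - \<sigma> N\<^sub>2\<close>. The system matrix is then the companion matrix with first block row
  \<open>C = [C\<^sub>1 \<dots> C\<^sub>d]\<close> and remaining rows \<open>L \<otimes> I\<close> (\<open>companion_shift\<close>). Let \<open>x\<close> be the approximate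
  solution of the system with \<open>P(\<sigma>)\<close>, let \<open>y\<^sub>1\<close> be the first block of \<open>y\<close>, and let \<open>y\<^sub>2\<close> collect
  its other blocks.

  Forward substitution solves the rows \<open>L \<otimes> I\<close> exactly, so that \<open>(L \<otimes> I) z = y\<^sub>2\<close> whatever \<open>x\<close>
  is (\<open>lower_rows_exact\<close>). Hence the residual has at most one nonzero block, \<open>y\<^sub>1 - C z\<close>.

  To compute \<open>C z\<close>, compare \<open>\<alpha> z\<close> with \<open>f(\<sigma>) \<otimes> x\<close>. The latter vector is sent to \<open>P(\<sigma>) x\<close> by \<open>C\<close>
  (\<open>block_row_mult_vec_kron\<close>) and to \<open>(L f(\<sigma>)) \<otimes> x = 0\<close> by \<open>L \<otimes> I\<close>. After the permutation both
  vectors have the first block \<open>\<alpha> x\<close>, so their difference lives in the trailing blocks, where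
  \<open>L \<otimes> I\<close> acts as the invertible matrix \<open>S \<otimes> I\<close>. Since \<open>L \<otimes> I\<close> maps the difference to \<open>\<alpha> y\<^sub>2\<close>,
  the trailing blocks are \<open>\<alpha> (S\<^sup>-\<^sup>1 \<otimes> I) y\<^sub>2\<close>, and therefore \<open>\<alpha> C z = P(\<sigma>) x + \<alpha> U\<^sub>1\<^sub>2 y\<^sub>2\<close>
  (\<open>scaled_first_row\<close>). In other words, \<open>\<alpha> (y\<^sub>1 - C z) = \<alpha> (y\<^sub>1 - U\<^sub>1\<^sub>2 y\<^sub>2) - P(\<sigma>) x = q\<close>.

  So the norm of \<open>q\<close> is \<open>\<bar>\<alpha>\<bar>\<close> times the norm of the residual, and the claim follows on dividing
  by \<open>\<bar>\<alpha>\<bar>\<close>. This is possible: if \<open>\<alpha> = 0\<close>, then \<open>L f(\<sigma>) = 0\<close> says that \<open>S\<close> annihilates the other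
  entries of the permuted \<open>f(\<sigma>)\<close>, and \<open>f(\<sigma>)\<close> would vanish (\<open>leading_entry_nonzero\<close>).
\<close>

section \<open>Kronecker products\<close>

text \<open>
  A Kronecker index \<open>c < d * n\<close> encodes the pair of block number \<open>c div n\<close> and position \<open>c mod n\<close>
  inside the block. The product rules for Kronecker products split their sums over \<open>c\<close> along this
  encoding.
\<close>

lemma sum_div_mod:
  fixes g :: "nat \<Rightarrow> nat \<Rightarrow> 'a :: comm_monoid_add"
  shows "(\<Sum>c = 0..<d * n. g (c div n) (c mod n)) = (\<Sum>i = 0..<d. \<Sum>j = 0..<n. g i j)"
proof -
  have "(\<Sum>c = m * n..<m * n + n. g (c div n) (c mod n)) = (\<Sum>j = 0..<n. g m j)" for m
  proof -
    have "(\<Sum>c = m * n..<m * n + n. g (c div n) (c mod n))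
        = (\<Sum>j = 0..<n. g ((j + m * n) div n) ((j + m * n) mod n))"
      using sum.shift_bounds_nat_ivl[of "\<lambda>c. g (c div n) (c mod n)" 0 "m * n" n]
      by (simp add: add.commute)
    also have "\<dots> = (\<Sum>j = 0..<n. g m j)"
      by (intro sum.cong) auto
    finally show ?thesis .
  qed
  then show ?thesis
    using sum.nat_group[of "\<lambda>c. g (c div n) (c mod n)" n d] by (simp add: lessThan_atLeast0)
qed

lemma kron_carrier [simp, intro]:
  "X \<in> carrier_mat a b \<Longrightarrow> Y \<in> carrier_mat a' b' \<Longrightarrow> X \<otimes>\<^sub>K Y \<in> carrier_mat (a * a') (b * b')"
  by (auto simp: kron_def)

lemma div_mod_less:
  fixes i :: nat
  assumes "i < a * b"
  shows "i div b < a" and "i mod b < b"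
  using assms by (auto simp: less_mult_imp_div_less intro!: mod_less_divisor gr0I)

lemma mult_kron:
  fixes X :: "'a :: comm_semiring_0 mat"
  assumes "X \<in> carrier_mat a b" "Y \<in> carrier_mat b c"
    and "U \<in> carrier_mat a' b'" "V \<in> carrier_mat b' c'"
  shows "(X \<otimes>\<^sub>K U) * (Y \<otimes>\<^sub>K V) = (X * Y) \<otimes>\<^sub>K (U * V)"
proof (rule eq_matI)
  fix i j
  assume "i < dim_row ((X * Y) \<otimes>\<^sub>K (U * V))" "j < dim_col ((X * Y) \<otimes>\<^sub>K (U * V))"
  then have ij: "i < a * a'" "j < c * c'"
    using assms by (auto simp: kron_def)
  note i = div_mod_less[OF ij(1)] and j = div_mod_less[OF ij(2)]
  have "((X \<otimes>\<^sub>K U) * (Y \<otimes>\<^sub>K V)) $$ (i, j)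
      = (\<Sum>k = 0..<b * b'. (X $$ (i div a', k div b') * U $$ (i mod a', k mod b'))
                          * (Y $$ (k div b', j div c') * V $$ (k mod b', j mod c')))"
    using assms ij by (auto simp: kron_def scalar_prod_def intro!: sum.cong)
  also have "\<dots> = (\<Sum>k = 0..<b. \<Sum>l = 0..<b'. (X $$ (i div a', k) * U $$ (i mod a', l))
                          * (Y $$ (k, j div c') * V $$ (l, j mod c')))"
    by (rule sum_div_mod)
  also have "\<dots> = (X * Y) $$ (i div a', j div c') * (U * V) $$ (i mod a', j mod c')"
    using assms i j by (simp add: scalar_prod_def sum_product, intro sum.cong refl) (simp add: mult_ac)
  also have "\<dots> = ((X * Y) \<otimes>\<^sub>K (U * V)) $$ (i, j)"
    using assms ij by (simp add: kron_def)
  finally show "((X \<otimes>\<^sub>K U) * (Y \<otimes>\<^sub>K V)) $$ (i, j) = ((X * Y) \<otimes>\<^sub>K (U * V)) $$ (i, j)" .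
qed (use assms in \<open>auto simp: kron_def\<close>)

lemma kron_one: "(1\<^sub>m a :: 'a :: semiring_1 mat) \<otimes>\<^sub>K 1\<^sub>m b = 1\<^sub>m (a * b)"
proof (rule eq_matI)
  fix i j
  assume "i < dim_row (1\<^sub>m (a * b) :: 'a mat)" "j < dim_col (1\<^sub>m (a * b) :: 'a mat)"
  then have ij: "i < a * b" "j < a * b" by auto
  have "i = j \<longleftrightarrow> i div b = j div b \<and> i mod b = j mod b"
    by (metis div_mult_mod_eq)
  then show "((1\<^sub>m a :: 'a mat) \<otimes>\<^sub>K 1\<^sub>m b) $$ (i, j) = (1\<^sub>m (a * b) :: 'a mat) $$ (i, j)"
    using ij div_mod_less[OF ij(1)] div_mod_less[OF ij(2)] by (auto simp: kron_def)
qed (auto simp: kron_def)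

lemma append_cols_carrier [simp, intro]:
  "X \<in> carrier_mat a b \<Longrightarrow> Y \<in> carrier_mat a c \<Longrightarrow> X @\<^sub>c Y \<in> carrier_mat a (b + c)"
  unfolding append_cols_def by (intro carrier_matI) auto

lemma append_cols_mult_vec:
  fixes X :: "'a :: comm_ring mat"
  assumes "X \<in> carrier_mat a b" "Y \<in> carrier_mat a c" "u \<in> carrier_vec b" "v \<in> carrier_vec c"
  shows "(X @\<^sub>c Y) *\<^sub>v (u @\<^sub>v v) = X *\<^sub>v u + Y *\<^sub>v v"
  unfolding append_cols_def
  using four_block_mat_mult_vec[OF assms(1,2) zero_carrier_mat zero_carrier_mat assms(3,4), of 0] assms
  by auto

lemma append_cols_diff_smult:
  fixes X :: "'a :: comm_ring mat"
  assumes "X \<in> carrier_mat a b" "Y \<in> carrier_mat a c" "X' \<in> carrier_mat a b" "Y' \<in> carrier_mat a c"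
  shows "(X @\<^sub>c Y) - s \<cdot>\<^sub>m (X' @\<^sub>c Y') = (X - s \<cdot>\<^sub>m X') @\<^sub>c (Y - s \<cdot>\<^sub>m Y')"
  using assms by (intro eq_matI) (auto simp: append_cols_def)

lemma diff_smult_mult_mat:
  fixes X :: "'a :: comm_ring_1 mat"
  assumes "X \<in> carrier_mat a b" "Y \<in> carrier_mat a b" "Q \<in> carrier_mat b c"
  shows "X * Q - s \<cdot>\<^sub>m (Y * Q) = (X - s \<cdot>\<^sub>m Y) * Q"
  using assms by (simp add: minus_mult_distrib_mat[of _ a b] mult_smult_assoc_mat[of _ a b])

lemma kron_append_cols:
  fixes X :: "'a :: semiring_0 mat"
  assumes "X \<in> carrier_mat a b" "Y \<in> carrier_mat a c" "V \<in> carrier_mat a' b'"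
  shows "(X @\<^sub>c Y) \<otimes>\<^sub>K V = (X \<otimes>\<^sub>K V) @\<^sub>c (Y \<otimes>\<^sub>K V)"
proof (rule eq_matI)
  fix i j
  assume "i < dim_row ((X \<otimes>\<^sub>K V) @\<^sub>c (Y \<otimes>\<^sub>K V))" "j < dim_col ((X \<otimes>\<^sub>K V) @\<^sub>c (Y \<otimes>\<^sub>K V))"
  then have ij: "i < a * a'" "j < (b + c) * b'"
    using assms by (auto simp: kron_def append_cols_def algebra_simps)
  note i = div_mod_less[OF ij(1)] and j = div_mod_less[OF ij(2)]
  show "((X @\<^sub>c Y) \<otimes>\<^sub>K V) $$ (i, j) = ((X \<otimes>\<^sub>K V) @\<^sub>c (Y \<otimes>\<^sub>K V)) $$ (i, j)"
  proof (cases "j < b * b'")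
    case True
    then show ?thesis
      using assms ij i j div_mod_less[OF True] by (auto simp: kron_def append_cols_def)
  next
    case False
    then obtain k where k: "j = b * b' + k" by (metis le_Suc_ex not_less)
    have "k < c * b'" using ij k by (simp add: algebra_simps)
    from div_mod_less[OF this] have "b' > 0" by simp
    then have shift: "j div b' = b + k div b'" "j mod b' = k mod b'" by (simp_all add: k)
    have "j - b * b' = k" by (simp add: k)
    with \<open>k < c * b'\<close> show ?thesis
      using assms ij False i div_mod_less[OF \<open>k < c * b'\<close>]
      by (simp add: kron_def append_cols_def shift algebra_simps)
  qed
qed (use assms in \<open>auto simp: kron_def append_cols_def algebra_simps\<close>)

text \<open>
  The column version of \<open>\<otimes>\<^sub>K\<close>, for vectors such as \<open>f(\<sigma>) \<otimes> x\<close> whose blocks are multiples of one vector.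
\<close>

definition vec_kron :: "'a :: semiring_0 vec \<Rightarrow> 'a vec \<Rightarrow> 'a vec" (infixl "\<otimes>\<^sub>V" 75) where
  "g \<otimes>\<^sub>V v = vec (dim_vec g * dim_vec v) (\<lambda>i. g $ (i div dim_vec v) * v $ (i mod dim_vec v))"

lemma vec_kron_carrier [simp, intro]:
  "g \<in> carrier_vec a \<Longrightarrow> v \<in> carrier_vec b \<Longrightarrow> g \<otimes>\<^sub>V v \<in> carrier_vec (a * b)"
  by (auto simp: vec_kron_def)

lemma zero_vec_kron:
  assumes "v \<in> carrier_vec b"
  shows "0\<^sub>v a \<otimes>\<^sub>V v = 0\<^sub>v (a * b)"
  using assms by (intro eq_vecI) (auto simp: vec_kron_def div_mod_less)

lemma vec_first_vec_kron:
  assumes "g \<in> carrier_vec (Suc a)" "v \<in> carrier_vec b"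
  shows "vec_first (g \<otimes>\<^sub>V v) b = g $ 0 \<cdot>\<^sub>v v"
  using assms by (intro eq_vecI) (auto simp: vec_kron_def vec_first_def)

lemma kron_mult_vec_kron:
  fixes X :: "'a :: comm_semiring_0 mat"
  assumes "X \<in> carrier_mat a b" "g \<in> carrier_vec b" "U \<in> carrier_mat a' b'" "v \<in> carrier_vec b'"
  shows "(X \<otimes>\<^sub>K U) *\<^sub>v (g \<otimes>\<^sub>V v) = (X *\<^sub>v g) \<otimes>\<^sub>V (U *\<^sub>v v)"
proof (rule eq_vecI)
  fix i
  assume "i < dim_vec ((X *\<^sub>v g) \<otimes>\<^sub>V (U *\<^sub>v v))"
  then have i: "i < a * a'" using assms by (auto simp: vec_kron_def)
  have "((X \<otimes>\<^sub>K U) *\<^sub>v (g \<otimes>\<^sub>V v)) $ i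
      = (\<Sum>k = 0..<b * b'. (X $$ (i div a', k div b') * U $$ (i mod a', k mod b'))
                          * (g $ (k div b') * v $ (k mod b')))"
    using assms i by (auto simp: kron_def vec_kron_def scalar_prod_def intro!: sum.cong)
  also have "\<dots> = (\<Sum>k = 0..<b. \<Sum>l = 0..<b'. (X $$ (i div a', k) * U $$ (i mod a', l))
                          * (g $ k * v $ l))"
    by (rule sum_div_mod)
  also have "\<dots> = (X *\<^sub>v g) $ (i div a') * (U *\<^sub>v v) $ (i mod a')"
    using assms div_mod_less[OF i] by (simp add: scalar_prod_def sum_product mult_ac)
  also have "\<dots> = ((X *\<^sub>v g) \<otimes>\<^sub>V (U *\<^sub>v v)) $ i"
    using assms i by (simp add: vec_kron_def)
  finally show "((X \<otimes>\<^sub>K U) *\<^sub>v (g \<otimes>\<^sub>V v)) $ i = ((X *\<^sub>v g) \<otimes>\<^sub>V (U *\<^sub>v v)) $ i" .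
qed (use assms in \<open>auto simp: kron_def vec_kron_def\<close>)

lemma kron_diff_smult:
  fixes X :: "'a :: comm_ring mat"
  assumes "X \<in> carrier_mat a b" "Y \<in> carrier_mat a b"
  shows "(X \<otimes>\<^sub>K V) - s \<cdot>\<^sub>m (Y \<otimes>\<^sub>K V) = (X - s \<cdot>\<^sub>m Y) \<otimes>\<^sub>K V"
  using assms by (intro eq_matI) (auto simp: kron_def div_mod_less algebra_simps)

section \<open>The companion linearization\<close>

lemma block_row_carrier [simp, intro]: "block_row n d A \<in> carrier_mat n (d * n)"
  by (simp add: block_row_def)

lemma block_row_diff_smult:
  fixes A B :: "nat \<Rightarrow> 'a :: comm_ring mat"
  assumes "\<And>i. i < d \<Longrightarrow> A i \<in> carrier_mat n n" "\<And>i. i < d \<Longrightarrow> B i \<in> carrier_mat n n"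
  shows "block_row n d A - s \<cdot>\<^sub>m block_row n d B = block_row n d (\<lambda>i. A i - s \<cdot>\<^sub>m B i)"
proof (rule eq_matI)
  fix i j
  assume "i < dim_row (block_row n d (\<lambda>i. A i - s \<cdot>\<^sub>m B i))"
    "j < dim_col (block_row n d (\<lambda>i. A i - s \<cdot>\<^sub>m B i))"
  then have ij: "i < n" "j < d * n" by (auto simp: block_row_def)
  note j = div_mod_less[OF ij(2)]
  show "(block_row n d A - s \<cdot>\<^sub>m block_row n d B) $$ (i, j)
      = block_row n d (\<lambda>i. A i - s \<cdot>\<^sub>m B i) $$ (i, j)"
    using ij j assms[OF j(1)] by (auto simp: block_row_def)
qed (auto simp: block_row_def)

text \<open>
  A shifted companion pencil is itself a companion matrix, so the analysis of the solver can work
  with one companion matrix instead of a pencil.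
\<close>

lemma companion_shift:
  assumes "\<And>i. i < d \<Longrightarrow> A i \<in> carrier_mat n n" "\<And>i. i < d \<Longrightarrow> B i \<in> carrier_mat n n"
    and "M \<in> carrier_mat e d" "N \<in> carrier_mat e d"
  shows "companion n d A M - s \<cdot>\<^sub>m companion n d B N
       = companion n d (\<lambda>i. A i - s \<cdot>\<^sub>m B i) (M - s \<cdot>\<^sub>m N)"
proof -
  have "companion n d A M - s \<cdot>\<^sub>m companion n d B N
      = (block_row n d A - s \<cdot>\<^sub>m block_row n d B)
        @\<^sub>r ((M \<otimes>\<^sub>K 1\<^sub>m n) - s \<cdot>\<^sub>m (N \<otimes>\<^sub>K 1\<^sub>m n))"
    unfolding companion_def append_rows_def block_row_def
    using assms(3,4) by (intro eq_matI) (auto simp: kron_def)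
  then show ?thesis
    using block_row_diff_smult[OF assms(1,2)] kron_diff_smult[OF assms(3,4)]
    by (simp add: companion_def)
qed

lemma companion_mult_vec:
  assumes "M \<in> carrier_mat e d" "v \<in> carrier_vec (d * n)"
  shows "companion n d A M *\<^sub>v v = (block_row n d A *\<^sub>v v) @\<^sub>v ((M \<otimes>\<^sub>K 1\<^sub>m n) *\<^sub>v v)"
  unfolding companion_def
  by (rule mat_mult_append[OF block_row_carrier kron_carrier[OF assms(1) one_carrier_mat] assms(2)])

text \<open>
  This is where \<open>P(\<mu>)\<close> enters: it is the first block row of the shifted linearization, seen on the
  vectors whose blocks are multiples of one \<open>v\<close> by the entries of \<open>f(\<mu>)\<close>.
\<close>

lemma block_row_mult_vec_kron:
  assumes "\<And>i. i < d \<Longrightarrow> A i \<in> carrier_mat n n" "\<And>i. i < d \<Longrightarrow> B i \<in> carrier_mat n n"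
    and "f \<mu> \<in> carrier_vec d" "v \<in> carrier_vec n"
  shows "block_row n d (\<lambda>i. A i - \<mu> \<cdot>\<^sub>m B i) *\<^sub>v (f \<mu> \<otimes>\<^sub>V v) = mat_fun n d A B f \<mu> *\<^sub>v v"
proof (rule eq_vecI)
  fix i
  assume "i < dim_vec (mat_fun n d A B f \<mu> *\<^sub>v v)"
  then have i: "i < n" by (simp add: mat_fun_def)
  let ?C = "\<lambda>k. A k - \<mu> \<cdot>\<^sub>m B k"
  have C: "?C k \<in> carrier_mat n n" if "k < d" for k
    using assms(1,2)[OF that] by auto
  have "(block_row n d ?C *\<^sub>v (f \<mu> \<otimes>\<^sub>V v)) $ i
      = (\<Sum>c = 0..<d * n. ?C (c div n) $$ (i, c mod n) * (f \<mu> $ (c div n) * v $ (c mod n)))"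
    using assms i by (auto simp: block_row_def vec_kron_def scalar_prod_def intro!: sum.cong)
  also have "\<dots> = (\<Sum>k = 0..<d. \<Sum>j = 0..<n. ?C k $$ (i, j) * (f \<mu> $ k * v $ j))"
    by (rule sum_div_mod)
  also have "\<dots> = (\<Sum>j = 0..<n. \<Sum>k = 0..<d. ?C k $$ (i, j) * (f \<mu> $ k * v $ j))"
    by (rule sum.swap)
  also have "\<dots> = (\<Sum>j = 0..<n. (\<Sum>k<d. (f \<mu> $ k \<cdot>\<^sub>m ?C k) $$ (i, j)) * v $ j)"
    using i carrier_matD[OF C]
    by (auto simp: sum_distrib_left lessThan_atLeast0 mult_ac intro!: sum.cong)
  also have "\<dots> = (mat_fun n d A B f \<mu> *\<^sub>v v) $ i"
    using assms i by (auto simp: mat_fun_def scalar_prod_def intro!: sum.cong)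
  finally show "(block_row n d ?C *\<^sub>v (f \<mu> \<otimes>\<^sub>V v)) $ i = (mat_fun n d A B f \<mu> *\<^sub>v v) $ i" .
qed (simp add: block_row_def mat_fun_def)

section \<open>Invertibility\<close>

text \<open>
  The predicate \<open>invertible_mat\<close> leaves the dimensions of the inverse open. Comparing column numbers
  shows that the inverse is square, so that the matrix is a unit and Gauss-Jordan elimination
  succeeds on it.
\<close>

lemma inv_mat:
  fixes X :: "'a :: field mat"
  assumes X: "X \<in> carrier_mat k k" and inv: "invertible_mat X"
  shows "inv_mat X \<in> carrier_mat k k" "X * inv_mat X = 1\<^sub>m k" "inv_mat X * X = 1\<^sub>m k"
proof -
  obtain Y where Y: "X * Y = 1\<^sub>m k" "Y * X = 1\<^sub>m (dim_row Y)"
    using inv X by (auto simp: invertible_mat_def inverts_mat_def)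
  have "dim_col Y = k" "dim_row Y = k"
    using arg_cong[OF Y(1), of dim_col] arg_cong[OF Y(2), of dim_col] X by auto
  then have "X \<in> Units (ring_mat TYPE('a) k ())"
    using X Y by (auto simp: Units_def ring_mat_def)
  then obtain Z where "mat_inverse X = Some Z"
    using mat_inverse(1)[OF X, where b = "()"] by (cases "mat_inverse X") auto
  then show "inv_mat X \<in> carrier_mat k k" "X * inv_mat X = 1\<^sub>m k" "inv_mat X * X = 1\<^sub>m k"
    using mat_inverse(2)[OF X] by (auto simp: inv_mat_def)
qed

lemma kron_one_inverse:
  fixes S :: "'a :: field mat"
  assumes "S \<in> carrier_mat e e" "invertible_mat S" "v \<in> carrier_vec (e * n)"
  shows "(S \<otimes>\<^sub>K 1\<^sub>m n) *\<^sub>v ((inv_mat S \<otimes>\<^sub>K 1\<^sub>m n) *\<^sub>v v) = v"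
    and "(inv_mat S \<otimes>\<^sub>K 1\<^sub>m n) *\<^sub>v ((S \<otimes>\<^sub>K 1\<^sub>m n) *\<^sub>v v) = v"
proof -
  note T = inv_mat[OF assms(1,2)]
  note one = one_carrier_mat[of n]
  show "(S \<otimes>\<^sub>K 1\<^sub>m n) *\<^sub>v ((inv_mat S \<otimes>\<^sub>K 1\<^sub>m n) *\<^sub>v v) = v"
    using assoc_mult_mat_vec[OF kron_carrier[OF assms(1) one] kron_carrier[OF T(1) one] assms(3)]
      mult_kron[OF assms(1) T(1) one one] assms(3) by (simp add: T kron_one)
  show "(inv_mat S \<otimes>\<^sub>K 1\<^sub>m n) *\<^sub>v ((S \<otimes>\<^sub>K 1\<^sub>m n) *\<^sub>v v) = v"
    using assoc_mult_mat_vec[OF kron_carrier[OF T(1) one] kron_carrier[OF assms(1) one] assms(3)]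
      mult_kron[OF T(1) assms(1) one one] assms(3) by (simp add: T kron_one)
qed

lemma permutation_mat_carrier: "permutation_mat d Q \<Longrightarrow> Q \<in> carrier_mat d d"
  by (auto simp: permutation_mat_def)

lemma permutation_mat_kernel:
  fixes v :: "'a :: semiring_1 vec"
  assumes "permutation_mat d Q" and v: "v \<in> carrier_vec d" and Qv: "Q *\<^sub>v v = 0\<^sub>v d"
  shows "v = 0\<^sub>v d"
proof (rule eq_vecI)
  obtain \<pi> where \<pi>: "\<pi> permutes {..<d}" and Q: "Q = mat d d (\<lambda>(i, j). if i = \<pi> j then 1 else 0)"
    using assms(1) by (auto simp: permutation_mat_def)
  fix j
  assume "j < dim_vec (0\<^sub>v d :: 'a vec)"
  then have j: "j < d" by simp
  then have \<pi>j: "\<pi> j < d" using permutes_in_image[OF \<pi>, of j] by simp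
  have "(Q *\<^sub>v v) $ \<pi> j = v $ j"
    using j \<pi>j v permutes_inj[OF \<pi>]
    by (simp add: Q scalar_prod_def inj_eq if_distrib[of "\<lambda>c. c * _"] cong: if_cong)
  then show "v $ j = 0\<^sub>v d $ j"
    using j \<pi>j Qv by simp
qed (use v in simp)

text \<open>
  A kernel vector of \<open>[r S]\<close> with invertible \<open>S\<close> is determined by its leading entry, so that entry
  cannot be zero unless the whole vector is. A permutation does not affect whether a vector is zero.
\<close>

lemma leading_entry_nonzero:
  fixes S :: "'a :: field mat"
  assumes Q: "permutation_mat (Suc e) Q"
    and r: "r \<in> carrier_mat e 1" and S: "S \<in> carrier_mat e e" and inv: "invertible_mat S"
    and f: "f \<in> carrier_vec (Suc e)" "f \<noteq> 0\<^sub>v (Suc e)"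
    and ker: "((r @\<^sub>c S) * Q) *\<^sub>v f = 0\<^sub>v e"
  shows "(Q *\<^sub>v f) $ 0 \<noteq> 0"
proof
  assume 0: "(Q *\<^sub>v f) $ 0 = 0"
  note Qc = permutation_mat_carrier[OF Q]
  have Qf: "Q *\<^sub>v f \<in> carrier_vec (1 + e)" using Qc f by auto
  define g where "g = vec_last (Q *\<^sub>v f) e"
  have g: "g \<in> carrier_vec e" by (simp add: g_def)
  have "vec_first (Q *\<^sub>v f) 1 = 0\<^sub>v 1" using 0 Qc by (intro eq_vecI) (auto simp: vec_first_def)
  then have split: "Q *\<^sub>v f = 0\<^sub>v 1 @\<^sub>v g"
    using vec_first_last_append[OF Qf] by (simp add: g_def)
  have "0\<^sub>v e = (r @\<^sub>c S) *\<^sub>v (Q *\<^sub>v f)"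
    using ker assoc_mult_mat_vec[OF append_cols_carrier[OF r S], of Q "Suc e" f] Qc f by simp
  also have "\<dots> = S *\<^sub>v g"
    using append_cols_mult_vec[OF r S _ g, of "0\<^sub>v 1"] r S g by (auto simp: split)
  finally have "inv_mat S *\<^sub>v (S *\<^sub>v g) = inv_mat S *\<^sub>v 0\<^sub>v e" by simp
  also have "\<dots> = 0\<^sub>v e"
    using inv_mat(1)[OF S inv] by (intro eq_vecI) auto
  finally have "g = 0\<^sub>v e"
    using assoc_mult_mat_vec[OF inv_mat(1)[OF S inv] S g] inv_mat(3)[OF S inv] g by simp
  then have "Q *\<^sub>v f = 0\<^sub>v (Suc e)" using split by (auto intro!: eq_vecI)
  then show False using permutation_mat_kernel[OF Q f(1)] f(2) by blast
qed

section \<open>Forward substitution with the decomposition\<close>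

text \<open>
  One step of the solver at a fixed shift: \<open>L\<close> and the blocks \<open>C i\<close> are already shifted, and
  \<open>substitution\<close> says that \<open>z\<close> comes from an arbitrary \<open>x\<close> by exact forward substitution. The number
  of blocks \<open>d\<close> is \<open>Suc e\<close>, which separates the leading block from the \<open>e\<close> trailing ones;
  \<open>C\<^sub>1\<close> and \<open>C\<^sub>2\<close> are the leading and the trailing columns of the first block row after the
  permutation.
\<close>

context
  fixes n e :: nat and C :: "nat \<Rightarrow> 'a :: field mat" and L Q r S C\<^sub>1 C\<^sub>2 :: "'a mat" and f x y z :: "'a vec"
  assumes Q: "Q \<in> carrier_mat (Suc e) (Suc e)"
    and r: "r \<in> carrier_mat e 1" and S: "S \<in> carrier_mat e e" and inv: "invertible_mat S"
    and L: "L = (r @\<^sub>c S) * Q"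
    and C\<^sub>1: "C\<^sub>1 \<in> carrier_mat n n" and C\<^sub>2: "C\<^sub>2 \<in> carrier_mat n (e * n)"
    and row: "block_row n (Suc e) C = (C\<^sub>1 @\<^sub>c C\<^sub>2) * (Q \<otimes>\<^sub>K 1\<^sub>m n)"
    and x: "x \<in> carrier_vec n" and y: "y \<in> carrier_vec (Suc e * n)"
    and z: "z \<in> carrier_vec (Suc e * n)"
    and substitution: "(Q \<otimes>\<^sub>K 1\<^sub>m n) *\<^sub>v z =
      x @\<^sub>v (inv_mat S \<otimes>\<^sub>K 1\<^sub>m n) *\<^sub>v (vec_last y (e * n) - (r \<otimes>\<^sub>K 1\<^sub>m n) *\<^sub>v x)"
begin

lemma kron_carriers:
  "Q \<otimes>\<^sub>K 1\<^sub>m n \<in> carrier_mat (Suc e * n) (Suc e * n)" "r \<otimes>\<^sub>K 1\<^sub>m n \<in> carrier_mat (e * n) n"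
  "S \<otimes>\<^sub>K 1\<^sub>m n \<in> carrier_mat (e * n) (e * n)" "inv_mat S \<otimes>\<^sub>K 1\<^sub>m n \<in> carrier_mat (e * n) (e * n)"
  "L \<otimes>\<^sub>K 1\<^sub>m n \<in> carrier_mat (e * n) (Suc e * n)"
proof -
  have "L \<in> carrier_mat e (Suc e)"
    using append_cols_carrier[OF r S] Q by (simp add: L)
  then show "L \<otimes>\<^sub>K 1\<^sub>m n \<in> carrier_mat (e * n) (Suc e * n)"
    by (rule kron_carrier) (rule one_carrier_mat)
  show "r \<otimes>\<^sub>K 1\<^sub>m n \<in> carrier_mat (e * n) n"
    using kron_carrier[OF r one_carrier_mat] by simp
qed (intro kron_carrier one_carrier_mat Q S inv_mat(1)[OF S inv])+

lemma permuted_lower_rows: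
  assumes v: "v \<in> carrier_vec (Suc e * n)" and "a \<in> carrier_vec n" "b \<in> carrier_vec (e * n)"
    and "(Q \<otimes>\<^sub>K 1\<^sub>m n) *\<^sub>v v = a @\<^sub>v b"
  shows "(L \<otimes>\<^sub>K 1\<^sub>m n) *\<^sub>v v = (r \<otimes>\<^sub>K 1\<^sub>m n) *\<^sub>v a + (S \<otimes>\<^sub>K 1\<^sub>m n) *\<^sub>v b"
proof -
  have rS: "r @\<^sub>c S \<in> carrier_mat e (Suc e)"
    using append_cols_carrier[OF r S] by simp
  have "L \<otimes>\<^sub>K 1\<^sub>m n = ((r @\<^sub>c S) \<otimes>\<^sub>K 1\<^sub>m n) * (Q \<otimes>\<^sub>K 1\<^sub>m n)"
    using mult_kron[OF rS Q one_carrier_mat one_carrier_mat] by (simp add: L)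
  then have "(L \<otimes>\<^sub>K 1\<^sub>m n) *\<^sub>v v = ((r @\<^sub>c S) \<otimes>\<^sub>K 1\<^sub>m n) *\<^sub>v (a @\<^sub>v b)"
    using assoc_mult_mat_vec[OF kron_carrier[OF rS one_carrier_mat] kron_carriers(1) v] assms(4) by simp
  also have "\<dots> = (r \<otimes>\<^sub>K 1\<^sub>m n) *\<^sub>v a + (S \<otimes>\<^sub>K 1\<^sub>m n) *\<^sub>v b"
    unfolding kron_append_cols[OF r S one_carrier_mat]
    by (rule append_cols_mult_vec[OF kron_carriers(2,3) assms(2,3)])
  finally show ?thesis .
qed

lemma permuted_first_row:
  assumes v: "v \<in> carrier_vec (Suc e * n)" and "a \<in> carrier_vec n" "b \<in> carrier_vec (e * n)"
    and "(Q \<otimes>\<^sub>K 1\<^sub>m n) *\<^sub>v v = a @\<^sub>v b"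
  shows "block_row n (Suc e) C *\<^sub>v v = C\<^sub>1 *\<^sub>v a + C\<^sub>2 *\<^sub>v b"
proof -
  have "C\<^sub>1 @\<^sub>c C\<^sub>2 \<in> carrier_mat n (Suc e * n)"
    using append_cols_carrier[OF C\<^sub>1 C\<^sub>2] by simp
  from assoc_mult_mat_vec[OF this kron_carriers(1) v]
  show ?thesis
    using append_cols_mult_vec[OF C\<^sub>1 C\<^sub>2 assms(2,3)] by (simp add: row assms(4))
qed

text \<open>
  The error committed in \<open>x\<close> does not reach these rows: the trailing blocks of \<open>z\<close> are chosen to
  compensate for the contribution of \<open>x\<close>, whatever \<open>x\<close> is.
\<close>

lemma lower_rows_exact: "(L \<otimes>\<^sub>K 1\<^sub>m n) *\<^sub>v z = vec_last y (e * n)"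
proof -
  let ?b = "vec_last y (e * n) - (r \<otimes>\<^sub>K 1\<^sub>m n) *\<^sub>v x"
  have rx: "(r \<otimes>\<^sub>K 1\<^sub>m n) *\<^sub>v x \<in> carrier_vec (e * n)"
    using kron_carriers(2) x by (rule mult_mat_vec_carrier)
  have b: "?b \<in> carrier_vec (e * n)"
    using rx by simp
  have "(L \<otimes>\<^sub>K 1\<^sub>m n) *\<^sub>v z = (r \<otimes>\<^sub>K 1\<^sub>m n) *\<^sub>v x + ?b"
    using permuted_lower_rows[OF z x mult_mat_vec_carrier[OF kron_carriers(4) b] substitution]
    by (simp only: kron_one_inverse(1)[OF S inv b])
  also have "\<dots> = vec_last y (e * n)"
  proof -
    have "u + (v - u) = v" if "u \<in> carrier_vec k" "v \<in> carrier_vec k" for u v :: "'a vec" and k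
      using that by (intro eq_vecI) auto
    then show ?thesis using rx by simp
  qed
  finally show ?thesis .
qed

text \<open>
  The vectors \<open>\<alpha> z\<close> and \<open>f \<otimes> x\<close> agree in the permuted leading block, and the lower rows determine
  the rest of their difference through \<open>S\<close>. The second summand is the image of that difference under
  the first block row; the matrix applied to the trailing blocks of \<open>y\<close> there is the block \<open>U\<^sub>1\<^sub>2\<close> of the
  decomposition.
\<close>

lemma scaled_first_row:
  assumes f: "f \<in> carrier_vec (Suc e)" and ker: "L *\<^sub>v f = 0\<^sub>v e" and \<alpha>: "\<alpha> = (Q *\<^sub>v f) $ 0"
  shows "\<alpha> \<cdot>\<^sub>v (block_row n (Suc e) C *\<^sub>v z)
    = block_row n (Suc e) C *\<^sub>v (f \<otimes>\<^sub>V x)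
      + \<alpha> \<cdot>\<^sub>v ((C\<^sub>2 * (inv_mat S \<otimes>\<^sub>K 1\<^sub>m n)) *\<^sub>v vec_last y (e * n))"
proof -
  let ?K = "\<lambda>X. X \<otimes>\<^sub>K 1\<^sub>m n" and ?R = "block_row n (Suc e) C" and ?y = "vec_last y (e * n)"
  have Lc: "L \<in> carrier_mat e (Suc e)"
    using append_cols_carrier[OF r S] Q by (simp add: L)
  have fx: "f \<otimes>\<^sub>V x \<in> carrier_vec (Suc e * n)" and \<alpha>z: "\<alpha> \<cdot>\<^sub>v z \<in> carrier_vec (Suc e * n)"
    using f x z by (auto simp del: mult_Suc)
  have y2: "?y \<in> carrier_vec (e * n)" by simp
  define t where "t = \<alpha> \<cdot>\<^sub>v z - f \<otimes>\<^sub>V x"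
  have t: "t \<in> carrier_vec (Suc e * n)"
    unfolding t_def using \<alpha>z fx by (rule minus_carrier_vec)
  have diff: "X *\<^sub>v t = \<alpha> \<cdot>\<^sub>v (X *\<^sub>v z) - X *\<^sub>v (f \<otimes>\<^sub>V x)" if "X \<in> carrier_mat k (Suc e * n)" for X k
    unfolding t_def mult_minus_distrib_mat_vec[OF that \<alpha>z fx] mult_mat_vec[OF that z] ..
  \<comment> \<open>the trailing part of the difference, after the permutation\<close>
  define b where "b = vec_last (?K Q *\<^sub>v t) (e * n)"
  have b: "b \<in> carrier_vec (e * n)" by (simp add: b_def)
  have Kt: "?K Q *\<^sub>v t = 0\<^sub>v n @\<^sub>v b"
  proof -
    have Qf: "Q *\<^sub>v f \<in> carrier_vec (Suc e)"
      using Q f by (rule mult_mat_vec_carrier)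
    have Qfx: "?K Q *\<^sub>v (f \<otimes>\<^sub>V x) = (Q *\<^sub>v f) \<otimes>\<^sub>V x"
      using kron_mult_vec_kron[OF Q f one_carrier_mat x] x by simp
    have "vec_first (?K Q *\<^sub>v t) n = \<alpha> \<cdot>\<^sub>v x - vec_first ((Q *\<^sub>v f) \<otimes>\<^sub>V x) n"
      using x vec_kron_carrier[OF Qf x]
      unfolding diff[OF kron_carriers(1)] Qfx substitution
      by (intro eq_vecI) (auto simp: vec_first_def)
    also have "\<dots> = 0\<^sub>v n"
      unfolding vec_first_vec_kron[OF Qf x] using x by (auto simp: \<alpha>)
    finally have first: "vec_first (?K Q *\<^sub>v t) n = 0\<^sub>v n" .
    have "?K Q *\<^sub>v t \<in> carrier_vec (n + e * n)"
      using mult_mat_vec_carrier[OF kron_carriers(1) t] by simp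
    from vec_first_last_append[OF this] show ?thesis
      by (simp add: first b_def)
  qed
  have "?K r *\<^sub>v 0\<^sub>v n = 0\<^sub>v (e * n)"
    using kron_carriers(2) by (intro eq_vecI) auto
  then have "?K S *\<^sub>v b = ?K L *\<^sub>v t"
    using permuted_lower_rows[OF t zero_carrier_vec b Kt] mult_mat_vec_carrier[OF kron_carriers(3) b]
    by simp
  also have "\<dots> = \<alpha> \<cdot>\<^sub>v ?y"
    using kron_mult_vec_kron[OF Lc f one_carrier_mat x] x
    by (simp add: diff[OF kron_carriers(5)] lower_rows_exact ker zero_vec_kron[OF x])
  finally have "b = ?K (inv_mat S) *\<^sub>v (\<alpha> \<cdot>\<^sub>v ?y)"
    using kron_one_inverse(2)[OF S inv b] by simp
  then have b_eq: "b = \<alpha> \<cdot>\<^sub>v (?K (inv_mat S) *\<^sub>v ?y)"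
    using mult_mat_vec[OF kron_carriers(4) y2] by simp
  have "?R *\<^sub>v t = C\<^sub>2 *\<^sub>v b"
    using permuted_first_row[OF t zero_carrier_vec b Kt] C\<^sub>1 C\<^sub>2 b by auto
  also have "\<dots> = \<alpha> \<cdot>\<^sub>v ((C\<^sub>2 * ?K (inv_mat S)) *\<^sub>v ?y)"
    using assoc_mult_mat_vec[OF C\<^sub>2 kron_carriers(4) y2]
      mult_mat_vec[OF C\<^sub>2 mult_mat_vec_carrier[OF kron_carriers(4) y2]] by (simp add: b_eq)
  finally have split: "\<alpha> \<cdot>\<^sub>v (?R *\<^sub>v z) - ?R *\<^sub>v (f \<otimes>\<^sub>V x) = \<alpha> \<cdot>\<^sub>v ((C\<^sub>2 * ?K (inv_mat S)) *\<^sub>v ?y)"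
    unfolding diff[OF block_row_carrier] .
  have "u = v + w" if "u - v = w" "u \<in> carrier_vec n" "v \<in> carrier_vec n"
    for u v w :: "'a vec"
    unfolding that(1)[symmetric] using that(2,3) by (intro eq_vecI) auto
  from this[OF split] show ?thesis
    by (simp add: carrier_vecI block_row_def)
qed

end

section \<open>The norm of the residual\<close>

lemma euclid_norm_smult: "euclid_norm (c \<cdot>\<^sub>v v) = cmod c * euclid_norm v"
  unfolding euclid_norm_def
  by (subst L2_set_right_distrib) (auto simp: norm_mult intro!: L2_set_cong)

lemma euclid_norm_append_zero: "euclid_norm (v @\<^sub>v 0\<^sub>v k) = euclid_norm v"
proof -
  have "(\<Sum>i<dim_vec v + k. (cmod ((v @\<^sub>v 0\<^sub>v k) $ i))\<^sup>2) = (\<Sum>i<dim_vec v. (cmod (v $ i))\<^sup>2)"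
    by (intro sum.mono_neutral_cong_right) auto
  then show ?thesis by (simp add: euclid_norm_def L2_set_def)
qed

lemma vec_block_0: "v \<in> carrier_vec (n + k) \<Longrightarrow> vec_block n v 0 = vec_first v n"
  by (auto simp: vec_block_def vec_first_def)

theorem proposition4p5:
  fixes n d p :: nat
    and A B :: "nat \<Rightarrow> complex mat"
    and f :: "complex \<Rightarrow> complex vec"
    and M N \<P> m\<^sub>1 n\<^sub>1 M\<^sub>2 N\<^sub>2 A\<^sub>1 A\<^sub>2 B\<^sub>1 B\<^sub>2 U\<^sub>1\<^sub>2 :: "complex mat"
    and \<sigma> \<alpha> :: complex
    and \<tau> :: real
    and y w z q :: "complex vec"
  assumes "\<tau> > 0" and "d \<ge> 1"
    \<comment> \<open>the companion linearization\<close>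
    and "\<And>i. i < d \<Longrightarrow> A i \<in> carrier_mat n n" and "\<And>i. i < d \<Longrightarrow> B i \<in> carrier_mat n n"
    and "\<And>\<mu>. f \<mu> \<in> carrier_vec d" and "\<And>\<mu>. f \<mu> \<noteq> 0\<^sub>v d"
    and "M \<in> carrier_mat (d - 1) d" and "N \<in> carrier_mat (d - 1) d"
    and "\<And>\<mu>. (M - \<mu> \<cdot>\<^sub>m N) *\<^sub>v f \<mu> = 0\<^sub>v (d - 1)"
    and "\<And>\<mu>. vec_space.rank (d - 1) (M - \<mu> \<cdot>\<^sub>m N) = d - 1"
    \<comment> \<open>the block ULP decomposition at \<open>\<sigma>\<close>\<close>
    and "permutation_mat d \<P>"
    and "m\<^sub>1 \<in> carrier_mat (d - 1) 1" and "M\<^sub>2 \<in> carrier_mat (d - 1) (d - 1)"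
    and "n\<^sub>1 \<in> carrier_mat (d - 1) 1" and "N\<^sub>2 \<in> carrier_mat (d - 1) (d - 1)"
    and "M = (m\<^sub>1 @\<^sub>c M\<^sub>2) * \<P>" and "N = (n\<^sub>1 @\<^sub>c N\<^sub>2) * \<P>"
    and "invertible_mat (M\<^sub>2 - \<sigma> \<cdot>\<^sub>m N\<^sub>2)"
    and "A\<^sub>1 \<in> carrier_mat n n" and "A\<^sub>2 \<in> carrier_mat n ((d - 1) * n)"
    and "B\<^sub>1 \<in> carrier_mat n n" and "B\<^sub>2 \<in> carrier_mat n ((d - 1) * n)"
    and "block_row n d A = (A\<^sub>1 @\<^sub>c A\<^sub>2) * (\<P> \<otimes>\<^sub>K 1\<^sub>m n)"
    and "block_row n d B = (B\<^sub>1 @\<^sub>c B\<^sub>2) * (\<P> \<otimes>\<^sub>K 1\<^sub>m n)"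
    and "\<alpha> = (\<P> *\<^sub>v f \<sigma>) $ 0"
    and "U\<^sub>1\<^sub>2 = (A\<^sub>2 - \<sigma> \<cdot>\<^sub>m B\<^sub>2) * (inv_mat (M\<^sub>2 - \<sigma> \<cdot>\<^sub>m N\<^sub>2) \<otimes>\<^sub>K 1\<^sub>m n)"
    and "p < d" and "\<P> *\<^sub>v unit_vec d p = unit_vec d 0"
    \<comment> \<open>solving with the decomposition; \<open>P(\<sigma>)\<close> may be solved inexactly\<close>
    and "y \<in> carrier_vec (d * n)" and "z \<in> carrier_vec (d * n)"
    and "w = (\<alpha> \<cdot>\<^sub>v (vec_block n y 0 - U\<^sub>1\<^sub>2 *\<^sub>v vec_last y ((d - 1) * n))) @\<^sub>v vec_last y ((d - 1) * n)"
    and "(\<P> \<otimes>\<^sub>K 1\<^sub>m n) *\<^sub>v z =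
           vec_block n z p @\<^sub>v
           (inv_mat (M\<^sub>2 - \<sigma> \<cdot>\<^sub>m N\<^sub>2) \<otimes>\<^sub>K 1\<^sub>m n) *\<^sub>v
             (vec_last w ((d - 1) * n) - ((m\<^sub>1 - \<sigma> \<cdot>\<^sub>m n\<^sub>1) \<otimes>\<^sub>K 1\<^sub>m n) *\<^sub>v vec_block n z p)"
    and "q = vec_block n w 0 - mat_fun n d A B f \<sigma> *\<^sub>v vec_block n z p"
    and "euclid_norm q \<le> cmod \<alpha> * \<tau>"
  shows "euclid_norm (y - (companion n d A M - \<sigma> \<cdot>\<^sub>m companion n d B N) *\<^sub>v z) \<le> \<tau>"
proof -
  obtain e where d: "d = Suc e" using \<open>d \<ge> 1\<close> by (cases d) auto
  let ?C = "\<lambda>i. A i - \<sigma> \<cdot>\<^sub>m B i" and ?L = "M - \<sigma> \<cdot>\<^sub>m N"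
  let ?R = "block_row n d ?C"
  define S where "S = M\<^sub>2 - \<sigma> \<cdot>\<^sub>m N\<^sub>2"
  define r where "r = m\<^sub>1 - \<sigma> \<cdot>\<^sub>m n\<^sub>1"
  define C\<^sub>1 where "C\<^sub>1 = A\<^sub>1 - \<sigma> \<cdot>\<^sub>m B\<^sub>1"
  define C\<^sub>2 where "C\<^sub>2 = A\<^sub>2 - \<sigma> \<cdot>\<^sub>m B\<^sub>2"
  define x where "x = vec_block n z p"
  define y\<^sub>2 where "y\<^sub>2 = vec_last y (e * n)"
  have perm: "permutation_mat (Suc e) \<P>" using assms(11) by (simp add: d)
  note Q = permutation_mat_carrier[OF perm]
  have S: "S \<in> carrier_mat e e" and r: "r \<in> carrier_mat e 1"
    and C\<^sub>1: "C\<^sub>1 \<in> carrier_mat n n" and C\<^sub>2: "C\<^sub>2 \<in> carrier_mat n (e * n)"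
    using assms(12-15,19-22) by (auto simp: d S_def r_def C\<^sub>1_def C\<^sub>2_def)
  have inv: "invertible_mat S" using assms(18) by (simp add: S_def)
  have x: "x \<in> carrier_vec n" by (simp add: x_def vec_block_def)
  have y: "y \<in> carrier_vec (Suc e * n)" and z: "z \<in> carrier_vec (Suc e * n)"
    using assms(29,30) by (simp_all add: d)
  have f: "f \<sigma> \<in> carrier_vec (Suc e)" "f \<sigma> \<noteq> 0\<^sub>v (Suc e)"
    using assms(5,6)[of \<sigma>] by (simp_all add: d)
  have L: "?L = (r @\<^sub>c S) * \<P>"
  proof -
    have "m\<^sub>1 @\<^sub>c M\<^sub>2 \<in> carrier_mat e (Suc e)" "n\<^sub>1 @\<^sub>c N\<^sub>2 \<in> carrier_mat e (Suc e)"
      using append_cols_carrier[of _ e 1 _ e] assms(12-15) by (simp_all add: d)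
    from diff_smult_mult_mat[OF this Q] show ?thesis
      using append_cols_diff_smult[of m\<^sub>1 e 1 M\<^sub>2 e n\<^sub>1 N\<^sub>2 \<sigma>] assms(12-15)
      by (simp add: assms(16,17) d r_def S_def)
  qed
  have row: "?R = (C\<^sub>1 @\<^sub>c C\<^sub>2) * (\<P> \<otimes>\<^sub>K 1\<^sub>m n)"
  proof -
    have K: "\<P> \<otimes>\<^sub>K 1\<^sub>m n \<in> carrier_mat (n + e * n) (n + e * n)"
      using kron_carrier[OF Q, of "1\<^sub>m n" n n] by simp
    have "?R = block_row n d A - \<sigma> \<cdot>\<^sub>m block_row n d B"
      using block_row_diff_smult[of d A n B \<sigma>] assms(3,4) by simp
    also have "\<dots> = ((A\<^sub>1 @\<^sub>c A\<^sub>2) - \<sigma> \<cdot>\<^sub>m (B\<^sub>1 @\<^sub>c B\<^sub>2)) * (\<P> \<otimes>\<^sub>K 1\<^sub>m n)"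
      unfolding assms(23,24)
      by (rule diff_smult_mult_mat[OF _ _ K]) (use assms(19-22) in \<open>auto simp: d\<close>)
    also have "(A\<^sub>1 @\<^sub>c A\<^sub>2) - \<sigma> \<cdot>\<^sub>m (B\<^sub>1 @\<^sub>c B\<^sub>2) = C\<^sub>1 @\<^sub>c C\<^sub>2"
      unfolding C\<^sub>1_def C\<^sub>2_def by (rule append_cols_diff_smult) (use assms(19-22) in auto)
    finally show ?thesis .
  qed
  have ker: "?L *\<^sub>v f \<sigma> = 0\<^sub>v e" using assms(9)[of \<sigma>] by (simp add: d)
  have \<alpha>_nonzero: "\<alpha> \<noteq> 0"
    using leading_entry_nonzero[OF perm r S inv f] ker by (simp add: assms(25) L)

  define w\<^sub>1 where "w\<^sub>1 = \<alpha> \<cdot>\<^sub>v (vec_first y n - U\<^sub>1\<^sub>2 *\<^sub>v y\<^sub>2)"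
  have U: "U\<^sub>1\<^sub>2 = C\<^sub>2 * (inv_mat S \<otimes>\<^sub>K 1\<^sub>m n)"
    using assms(26) by (simp add: C\<^sub>2_def S_def)
  have Uy: "U\<^sub>1\<^sub>2 *\<^sub>v y\<^sub>2 \<in> carrier_vec n"
    using C\<^sub>2 by (intro carrier_vecI) (simp add: U)
  have w\<^sub>1: "w\<^sub>1 \<in> carrier_vec n" using Uy by (simp add: w\<^sub>1_def)
  have w: "w = w\<^sub>1 @\<^sub>v y\<^sub>2"
    using assms(31) vec_block_0[of y n "e * n"] y by (simp add: d w\<^sub>1_def y\<^sub>2_def)
  have w_blocks: "vec_block n w 0 = w\<^sub>1" "vec_last w (e * n) = y\<^sub>2"
    unfolding w using w\<^sub>1 by (auto simp: vec_block_def vec_last_def y\<^sub>2_def)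
  have substitution: "(\<P> \<otimes>\<^sub>K 1\<^sub>m n) *\<^sub>v z =
      x @\<^sub>v (inv_mat S \<otimes>\<^sub>K 1\<^sub>m n) *\<^sub>v (vec_last y (e * n) - (r \<otimes>\<^sub>K 1\<^sub>m n) *\<^sub>v x)"
    using assms(32) w_blocks by (simp add: d x_def r_def S_def y\<^sub>2_def)

  \<comment> \<open>the first block of the residual\<close>
  define \<rho> where "\<rho> = vec_first y n - ?R *\<^sub>v z"
  have Rz: "?R *\<^sub>v z \<in> carrier_vec n" by (intro carrier_vecI) (simp add: block_row_def)
  have residual: "y - (companion n d A M - \<sigma> \<cdot>\<^sub>m companion n d B N) *\<^sub>v z = \<rho> @\<^sub>v 0\<^sub>v (e * n)"
  proof -
    have "(companion n d A M - \<sigma> \<cdot>\<^sub>m companion n d B N) *\<^sub>v z = (?R *\<^sub>v z) @\<^sub>v ((?L \<otimes>\<^sub>K 1\<^sub>m n) *\<^sub>v z)"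
    proof -
      have "?L \<in> carrier_mat e (Suc e)"
        using assms(8) by (auto simp: d)
      from companion_mult_vec[OF this z, of ?C] show ?thesis
        using companion_shift[of d A n B M e N \<sigma>] assms(3,4,7,8) by (simp add: d)
    qed
    also have "(?L \<otimes>\<^sub>K 1\<^sub>m n) *\<^sub>v z = y\<^sub>2"
      unfolding y\<^sub>2_def
      by (rule lower_rows_exact[OF Q r S inv L C\<^sub>1 C\<^sub>2 row[unfolded d] x y z substitution])
    finally have "(companion n d A M - \<sigma> \<cdot>\<^sub>m companion n d B N) *\<^sub>v z = (?R *\<^sub>v z) @\<^sub>v y\<^sub>2" .
    moreover have "y = vec_first y n @\<^sub>v y\<^sub>2"
      using vec_first_last_append[of y n "e * n"] y by (simp add: y\<^sub>2_def)
    moreover have "(u @\<^sub>v c) - (v @\<^sub>v c) = (u - v) @\<^sub>v 0\<^sub>v k"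
      if "u \<in> carrier_vec n" "v \<in> carrier_vec n" "c \<in> carrier_vec k" for u v c :: "complex vec" and k
      using that by (intro eq_vecI) auto
    from this[OF vec_first_carrier Rz vec_last_carrier]
    have "(vec_first y n @\<^sub>v y\<^sub>2) - ((?R *\<^sub>v z) @\<^sub>v y\<^sub>2) = \<rho> @\<^sub>v 0\<^sub>v (e * n)"
      unfolding \<rho>_def y\<^sub>2_def .
    ultimately show ?thesis by simp
  qed
  have q: "q = \<alpha> \<cdot>\<^sub>v \<rho>"
  proof -
    have Px: "?R *\<^sub>v (f \<sigma> \<otimes>\<^sub>V x) = mat_fun n d A B f \<sigma> *\<^sub>v x"
      using block_row_mult_vec_kron[of d A n B f \<sigma> x] assms(3,4,5) x by simp
    have Rz_eq: "\<alpha> \<cdot>\<^sub>v (?R *\<^sub>v z) = mat_fun n d A B f \<sigma> *\<^sub>v x + \<alpha> \<cdot>\<^sub>v (U\<^sub>1\<^sub>2 *\<^sub>v y\<^sub>2)"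
      using scaled_first_row[OF Q r S inv L C\<^sub>1 C\<^sub>2 row[unfolded d] x y z substitution f(1) ker assms(25)]
      by (simp add: d[symmetric] Px U y\<^sub>2_def)
    have P: "mat_fun n d A B f \<sigma> *\<^sub>v x \<in> carrier_vec n"
      by (intro carrier_vecI) (simp add: mat_fun_def)
    have "\<alpha> \<cdot>\<^sub>v (u - b) - a = \<alpha> \<cdot>\<^sub>v (u - c)"
      if "\<alpha> \<cdot>\<^sub>v c = a + \<alpha> \<cdot>\<^sub>v b"
        and "u \<in> carrier_vec n" "a \<in> carrier_vec n" "b \<in> carrier_vec n" "c \<in> carrier_vec n"
      for u a b c :: "complex vec"
    proof (rule eq_vecI)
      fix i
      assume "i < dim_vec (\<alpha> \<cdot>\<^sub>v (u - c))"
      then have "i < n" using that(5) by simp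
      moreover have "(\<alpha> \<cdot>\<^sub>v c) $ i = (a + \<alpha> \<cdot>\<^sub>v b) $ i" by (simp only: that(1))
      ultimately show "(\<alpha> \<cdot>\<^sub>v (u - b) - a) $ i = (\<alpha> \<cdot>\<^sub>v (u - c)) $ i"
        using that(2-5) by (simp add: algebra_simps)
    qed (use that in simp)
    from this[OF Rz_eq vec_first_carrier P Uy Rz]
    show ?thesis
      by (simp add: assms(33) w_blocks x_def[symmetric] w\<^sub>1_def \<rho>_def)
  qed
  have "cmod \<alpha> * euclid_norm \<rho> \<le> cmod \<alpha> * \<tau>"
    using assms(34) by (simp add: q euclid_norm_smult)
  then show ?thesis
    using \<alpha>_nonzero by (simp add: residual euclid_norm_append_zero)
qed

end
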